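(* The matching data on $\Sigma$ do not uniquely determine the local exterior solution. Precisely: let $r_0>0$, let $I$ be an open interval, let $a:I\to(0,\infty)$ be smooth with $1-r_0\dot a(t)\ne0$ on $I$, and let $M(v,r_v)$ be a smooth function on an open neighborhood of $\Sigma=\{(\mathcal{T}(t),\mathcal{R}(t)):t\in I\}$ satisfying the full set of matching conditions (M1)--(M6) of metric $f(R)$ gravity between the spatially flat FLRW interior with scale factor $a$ and the generalized Vaidya exterior with mass function $M$, no restriction being imposed on the exterior matter content. Then there is a smooth function $\widetilde M(v,r_v)$ on an open neighborhood of $\Sigma$ which satisfies the same matching conditions (M1)--(M6) (with the same $a$, $r_0$, $\mathcal{T}$, $\mathcal{R}$), but such that in every neighborhood $W$ of $\Sigma$ there are points on the exterior side of $\Sigma$ at which $\widetilde M\neq M$.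
   Context: The interior metric is $ds_-^2=-dt^2+a^2(t)(dr^2+r^2d\Omega^2)$, with Ricci scalar $R_-(t)=6\left(\frac{\ddot a}{a}+\frac{\dot a^2}{a^2}\right)$. The exterior (generalized Vaidya) metric is $ds_+^2=-\left(1-\frac{2M(v,r_v)}{r_v}\right)dv^2+2\,dv\,dr_v+r_v^2d\Omega^2$, with Ricci scalar $R_+(v,r_v)=\frac{2}{r_v^2}\left(r_vM_{,r_vr_v}+2M_{,r_v}\right)$. Subscripts after a comma are partial derivatives; a dot is $d/dt$. The matching hypersurface $\Sigma$ is $r=r_0$ from the interior and $v=\mathcal{T}(t)$, $r_v=\mathcal{R}(t)$ from the exterior. Since $\dot{\mathcal T}\neq0$, $\mathcal T$ is injective on $I$, and the exterior side of $\Sigma$ is $\{(v,r_v): v=\mathcal{T}(t)\text{ for some }t\in I,\ r_v>\mathcal{R}(t)\}$. Regular matching in metric $f(R)$ gravity with $f_{,RR}\neq0$ (continuity across $\Sigma$ of the induced metric, the extrinsic curvature, the Ricci scalar, and the normal derivative of the Ricci scalar) amounts here to: (M1) $\mathcal{R}(t)=r_0a(t)$; (M2) $\dot{\mathcal{T}}(t)=\frac{1}{1-r_0\dot a(t)}$; (M3) $M(\mathcal{T}(t),\mathcal{R}(t))=\frac{r_0^3}{2}a\dot a^2$; (M4) $M_{,r_v}(\mathcal{T}(t),\mathcal{R}(t))=r_0^2\left(\frac12\dot a^2+a\ddot a\right)$; (M5) $R_+(\mathcal{T}(t),\mathcal{R}(t))=R_-(t)$; (M6) $\left[\partial_vR_++(1-\dot{\mathcal{R}}(t))\,\partial_{r_v}R_+\right](\mathcal{T}(t),\mathcal{R}(t))=0$.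 "No restriction on the exterior matter content" means that the exterior energy-momentum tensor $T_{\mu\nu}$ is whatever the field equations $f_{,R}R_{\mu\nu}-\frac12 f g_{\mu\nu}+(g_{\mu\nu}\Box-\nabla_\mu\nabla_\nu)f_{,R}=\kappa T_{\mu\nu}$ yield for the exterior metric. *)

theory Defs
  imports "HOL-Analysis.Analysis"
begin

text \<open>
  \<open>C\<^sup>n\<close> on an open set \<open>S\<close>, via iterated directional derivatives. The values of \<open>f\<close> outside the
  open set \<open>S\<close> are irrelevant.
\<close>

fun C_n_on :: "nat \<Rightarrow> ('a::real_normed_vector \<Rightarrow> 'b::real_normed_vector) \<Rightarrow> 'a set \<Rightarrow> bool" where
  "C_n_on 0 f S \<longleftrightarrow> continuous_on S f"
| "C_n_on (Suc n) f S \<longleftrightarrow>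
     (\<forall>x\<in>S. f differentiable (at x)) \<and> (\<forall>h. C_n_on n (\<lambda>x. frechet_derivative f (at x) h) S)"

definition smooth_on :: "('a::real_normed_vector \<Rightarrow> 'b::real_normed_vector) \<Rightarrow> 'a set \<Rightarrow> bool" where
  "smooth_on f S \<longleftrightarrow> (\<forall>n. C_n_on n f S)"

text \<open>Points of the exterior half-plane are pairs \<open>(v, r\<^sub>v)\<close>.\<close>

definition partial_v :: "(real \<times> real \<Rightarrow> real) \<Rightarrow> real \<times> real \<Rightarrow> real" where
  "partial_v F p = deriv (\<lambda>v. F (v, snd p)) (fst p)"

definition partial_r :: "(real \<times> real \<Rightarrow> real) \<Rightarrow> real \<times> real \<Rightarrow> real" where
  "partial_r F p = deriv (\<lambda>r. F (fst p, r)) (snd p)"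

text \<open>
  Ricci scalar of the spatially flat FLRW metric
  \<open>- dt\<^sup>2 + a(t)\<^sup>2 (dr\<^sup>2 + r\<^sup>2 d\<Omega>\<^sup>2)\<close>.
\<close>

definition ricci_int :: "(real \<Rightarrow> real) \<Rightarrow> real \<Rightarrow> real" where
  "ricci_int a t = 6 * (deriv (deriv a) t / a t + (deriv a t)\<^sup>2 / (a t)\<^sup>2)"

text \<open>
  Ricci scalar of the generalized Vaidya metric
  \<open>- (1 - 2 M(v, r\<^sub>v) / r\<^sub>v) dv\<^sup>2 + 2 dv dr\<^sub>v + r\<^sub>v\<^sup>2 d\<Omega>\<^sup>2\<close>.
\<close>

definition ricci_ext :: "(real \<times> real \<Rightarrow> real) \<Rightarrow> real \<times> real \<Rightarrow> real" where
  "ricci_ext M p = 2 / (snd p)\<^sup>2 * (snd p * partial_r (partial_r M) p + 2 * partial_r M p)"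

definition hypersurface :: "real set \<Rightarrow> (real \<Rightarrow> real) \<Rightarrow> (real \<Rightarrow> real) \<Rightarrow> (real \<times> real) set" where
  "hypersurface I T R = {(T t, R t) | t. t \<in> I}"

definition exterior_side :: "real set \<Rightarrow> (real \<Rightarrow> real) \<Rightarrow> (real \<Rightarrow> real) \<Rightarrow> (real \<times> real) set" where
  "exterior_side I T R = {(v, r). \<exists>t\<in>I. v = T t \<and> R t < r}"

text \<open>
  Matching conditions across the hypersurface between the FLRW interior \<open>r \<le> r0\<close> with scale factor
  \<open>a\<close> and the generalized Vaidya exterior with mass function \<open>M\<close>: the first four express continuity of
  the induced metric and of the extrinsic curvature, the last two continuity of the Ricci scalar and
  of its normal derivative. The function \<open>f\<close> of the gravity theory does not enter (beyond
  \<open>f'' \<noteq> 0\<close>, which is what makes the last two conditions necessary), nor does the exterior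
  energy-momentum tensor, which the field equations determine from the exterior metric and on
  which nothing is imposed.
\<close>

definition matching_conditions ::
  "real \<Rightarrow> real set \<Rightarrow> (real \<Rightarrow> real) \<Rightarrow> (real \<Rightarrow> real) \<Rightarrow> (real \<Rightarrow> real) \<Rightarrow> (real \<times> real \<Rightarrow> real) \<Rightarrow> bool"
where
  "matching_conditions r0 I a T R M \<longleftrightarrow> (\<forall>t\<in>I.
     R t = r0 * a t \<and>
     (T has_real_derivative 1 / (1 - r0 * deriv a t)) (at t) \<and>
     M (T t, R t) = r0 ^ 3 / 2 * a t * (deriv a t)\<^sup>2 \<and>
     partial_r M (T t, R t) = r0\<^sup>2 * (1 / 2 * (deriv a t)\<^sup>2 + a t * deriv (deriv a) t) \<and>
     ricci_ext M (T t, R t) = ricci_int a t \<and>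
     partial_v (ricci_ext M) (T t, R t)
       + (1 - deriv R t) * partial_r (ricci_ext M) (T t, R t) = 0)"

end

theory Submission
  imports Defs
begin

text \<open>
  Write \<open>\<Sigma>\<close> as the graph \<open>r\<^sub>v = g(v)\<close> over the open set \<open>T ` I\<close>, with \<open>g = R \<circ> T\<^sup>-\<^sup>1\<close>. The conditions
  (M3)--(M6) see only the 3-jet of the mass function along \<open>\<Sigma>\<close>, so adding \<open>(r\<^sub>v - g(v))\<^sup>4\<close>, which is
  nonzero off \<open>\<Sigma>\<close>, preserves them. Smoothness of \<open>g\<close> comes from (M2): \<open>T\<^sup>-\<^sup>1\<close> is an integral
  curve of the smooth vector field \<open>1 - r0 a'\<close>, so the functions \<open>\<phi> \<circ> T\<^sup>-\<^sup>1\<close> with \<open>\<phi>\<close> smooth are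
  closed under differentiation.
\<close>

section \<open>Calculus of \<open>C_n_on\<close> and \<open>smooth_on\<close> on open sets\<close>

text \<open>Having a given derivative at \<open>x\<close> is a local property, so both sides are
  choices from one and the same set of derivatives; they agree even where that set is empty.\<close>

lemma frechet_derivative_cong_open:
  assumes "open S" "x \<in> S" "\<And>y. y \<in> S \<Longrightarrow> f y = g y"
  shows "frechet_derivative f (at x) = frechet_derivative g (at x)"
proof -
  have "(f has_derivative D) (at x) \<longleftrightarrow> (g has_derivative D) (at x)" for D
    using has_derivative_transform_within_open[OF _ assms(1,2)] assms(3) by metis
  then show ?thesis unfolding frechet_derivative_def by simp
qed

lemma differentiable_cong_open:
  assumes "open S" "x \<in> S" "\<And>y. y \<in> S \<Longrightarrow> f y = g y" "f differentiable (at x)"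
  shows "g differentiable (at x)"
  using assms(4) has_derivative_transform_within_open[OF _ assms(1,2)] assms(3)
  unfolding differentiable_def by metis

lemma C_n_on_cong:
  assumes "open S" "\<And>x. x \<in> S \<Longrightarrow> f x = g x" "C_n_on n f S"
  shows "C_n_on n g S"
  using assms(2,3)
proof (induction n arbitrary: f g)
  case 0
  then show ?case by (metis C_n_on.simps(1) continuous_on_cong)
next
  case (Suc n)
  have "C_n_on n (\<lambda>x. frechet_derivative g (at x) h) S" for h
  proof (rule Suc.IH[of "\<lambda>x. frechet_derivative f (at x) h"])
    show "frechet_derivative f (at x) h = frechet_derivative g (at x) h" if "x \<in> S" for x
      using frechet_derivative_cong_open[OF assms(1) that] Suc.prems(1) by metis
    show "C_n_on n (\<lambda>x. frechet_derivative f (at x) h) S" using Suc.prems(2) by simp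
  qed
  moreover have "g differentiable (at x)" if "x \<in> S" for x
    using differentiable_cong_open[OF assms(1) that, of f g] Suc.prems that by simp
  ultimately show ?case by simp
qed

text \<open>Replaces the chosen \<open>frechet_derivative\<close> by an explicit formula
  \<open>D\<close>, so that each closure property below reduces to a differentiation rule and the
  induction hypothesis.\<close>

lemma C_n_on_SucI:
  assumes "open S"
    and "\<And>x. x \<in> S \<Longrightarrow> (f has_derivative D x) (at x)"
    and "\<And>h. C_n_on n (\<lambda>x. D x h) S"
  shows "C_n_on (Suc n) f S"
proof -
  have "C_n_on n (\<lambda>x. frechet_derivative f (at x) h) S" for h
    using assms(2) by (intro C_n_on_cong[OF assms(1) _ assms(3)[of h]])
      (metis frechet_derivative_at)
  then show ?thesis using assms(2) by (auto simp: differentiable_def)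
qed

lemma C_n_on_imp_continuous_on: "C_n_on n f S \<Longrightarrow> continuous_on S f"
  by (cases n) (auto intro!: continuous_at_imp_continuous_on differentiable_imp_continuous_within)

lemma C_n_on_SucD: "C_n_on (Suc n) f S \<Longrightarrow> C_n_on n f S"
proof (induction n arbitrary: f)
  case 0
  then show ?case using C_n_on_imp_continuous_on C_n_on.simps(1) by blast
next
  case (Suc n)
  then show ?case by simp
qed

lemma C_n_on_subset: "C_n_on n f S \<Longrightarrow> S' \<subseteq> S \<Longrightarrow> C_n_on n f S'"
  by (induction n arbitrary: f) (auto intro: continuous_on_subset)

lemma C_n_on_const: "open S \<Longrightarrow> C_n_on n (\<lambda>x. c) S"
  by (induction n arbitrary: c) (auto intro: C_n_on_SucI[where D = "\<lambda>x h. 0"])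

lemma C_n_on_add:
  assumes "open S" "C_n_on n f S" "C_n_on n g S"
  shows "C_n_on n (\<lambda>x. f x + g x) S"
  using assms(2,3)
proof (induction n arbitrary: f g)
  case 0
  then show ?case by (auto intro: continuous_intros)
next
  case (Suc n)
  show ?case
  proof (rule C_n_on_SucI[OF assms(1)])
    show "((\<lambda>x. f x + g x) has_derivative
        (\<lambda>h. frechet_derivative f (at x) h + frechet_derivative g (at x) h)) (at x)"
      if "x \<in> S" for x
      using that Suc.prems by (intro has_derivative_add) (simp_all flip: frechet_derivative_works)
  qed (use Suc in simp)
qed

lemma C_n_on_mult:
  fixes f g :: "'a::real_normed_vector \<Rightarrow> 'b::real_normed_algebra"
  assumes "open S" "C_n_on n f S" "C_n_on n g S"
  shows "C_n_on n (\<lambda>x. f x * g x) S"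
  using assms(2,3)
proof (induction n arbitrary: f g)
  case 0
  then show ?case by (auto intro: continuous_intros)
next
  case (Suc n)
  show ?case
  proof (rule C_n_on_SucI[OF assms(1)])
    show "((\<lambda>x. f x * g x) has_derivative
        (\<lambda>h. f x * frechet_derivative g (at x) h + frechet_derivative f (at x) h * g x)) (at x)"
      if "x \<in> S" for x
      using that Suc.prems by (intro has_derivative_mult) (simp_all flip: frechet_derivative_works)
    show "C_n_on n (\<lambda>x. f x * frechet_derivative g (at x) h
        + frechet_derivative f (at x) h * g x) S" for h
      using Suc.prems C_n_on_SucD[OF Suc.prems(1)] C_n_on_SucD[OF Suc.prems(2)]
      by (intro C_n_on_add assms(1) Suc.IH) simp_all
  qed
qed

text \<open>The derivative of \<open>L\<close> is \<open>L\<close> at every point, so each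
  directional derivative is constant and one differentiation already leads to
  \<open>C_n_on_const\<close>.\<close>

lemma C_n_on_bounded_linear:
  assumes "open S" "bounded_linear L"
  shows "C_n_on n L S"
proof (cases n)
  case 0
  then show ?thesis using assms(2) by (simp add: linear_continuous_on)
next
  case (Suc m)
  then show ?thesis
    using assms by (auto intro!: C_n_on_SucI[where D = "\<lambda>x. L"] C_n_on_const
        bounded_linear_imp_has_derivative simp del: C_n_on.simps)
qed

text \<open>Differentiating in direction \<open>h\<close> gives the derivative of \<open>f\<close>
  in the fixed direction \<open>L h\<close>, again composed with \<open>L\<close>, so the shape of
  the claim survives the induction. It serves to regard \<open>g\<close> as a function of the pair
  through \<open>fst\<close>.\<close>

lemma C_n_on_compose_linear:
  assumes "open S" "bounded_linear L" "L ` S \<subseteq> S'" "C_n_on n f S'"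
  shows "C_n_on n (\<lambda>x. f (L x)) S"
  using assms(4)
proof (induction n arbitrary: f)
  case 0
  then show ?case
    using continuous_on_compose2[OF _ linear_continuous_on[OF assms(2)] assms(3)] by simp
next
  case (Suc n)
  show ?case
  proof (rule C_n_on_SucI[OF assms(1)])
    show "((\<lambda>x. f (L x)) has_derivative (\<lambda>h. frechet_derivative f (at (L x)) (L h))) (at x)"
      if "x \<in> S" for x
      using that Suc.prems assms(3)
      by (intro has_derivative_compose[OF bounded_linear_imp_has_derivative[OF assms(2)]])
        (auto simp flip: frechet_derivative_works)
    show "C_n_on n (\<lambda>x. frechet_derivative f (at (L x)) (L h)) S" for h
      using Suc.IH[of "\<lambda>x. frechet_derivative f (at x) (L h)"] Suc.prems by simp
  qed
qed

lemma smooth_on_subset: "smooth_on f S \<Longrightarrow> S' \<subseteq> S \<Longrightarrow> smooth_on f S'"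
  unfolding smooth_on_def using C_n_on_subset by blast

lemma smooth_on_const: "open S \<Longrightarrow> smooth_on (\<lambda>x. c) S"
  by (simp add: smooth_on_def C_n_on_const)

lemma smooth_on_add:
  "open S \<Longrightarrow> smooth_on f S \<Longrightarrow> smooth_on g S \<Longrightarrow> smooth_on (\<lambda>x. f x + g x) S"
  by (simp add: smooth_on_def C_n_on_add)

lemma smooth_on_mult:
  fixes f g :: "'a::real_normed_vector \<Rightarrow> 'b::real_normed_algebra"
  shows "open S \<Longrightarrow> smooth_on f S \<Longrightarrow> smooth_on g S \<Longrightarrow> smooth_on (\<lambda>x. f x * g x) S"
  by (simp add: smooth_on_def C_n_on_mult)

lemma smooth_on_diff:
  fixes f g :: "'a::real_normed_vector \<Rightarrow> 'b::real_normed_algebra_1"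
  assumes "open S" "smooth_on f S" "smooth_on g S"
  shows "smooth_on (\<lambda>x. f x - g x) S"
  using smooth_on_add[OF assms(1,2) smooth_on_mult[OF assms(1) smooth_on_const[OF assms(1)] assms(3)],
      of "- 1"] by simp

lemma smooth_on_power:
  fixes f :: "'a::real_normed_vector \<Rightarrow> 'b::real_normed_algebra_1"
  shows "open S \<Longrightarrow> smooth_on f S \<Longrightarrow> smooth_on (\<lambda>x. f x ^ k) S"
  by (induction k) (simp_all add: smooth_on_const smooth_on_mult)

lemma smooth_on_bounded_linear: "open S \<Longrightarrow> bounded_linear L \<Longrightarrow> smooth_on L S"
  by (simp add: smooth_on_def C_n_on_bounded_linear)

lemma smooth_on_compose_linear:
  "open S \<Longrightarrow> bounded_linear L \<Longrightarrow> L ` S \<subseteq> S' \<Longrightarrow> smooth_on f S' \<Longrightarrow> smooth_on (\<lambda>x. f (L x)) S"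
  unfolding smooth_on_def using C_n_on_compose_linear by blast

lemma smooth_on_imp_continuous_on: "smooth_on f S \<Longrightarrow> continuous_on S f"
  unfolding smooth_on_def using C_n_on_imp_continuous_on by blast

lemma smooth_on_imp_differentiable: "smooth_on f S \<Longrightarrow> x \<in> S \<Longrightarrow> f differentiable (at x)"
  unfolding smooth_on_def using C_n_on.simps(2) by blast

lemma smooth_on_frechet_derivative:
  "smooth_on f S \<Longrightarrow> smooth_on (\<lambda>x. frechet_derivative f (at x) h) S"
  unfolding smooth_on_def using C_n_on.simps(2) by blast

lemma smooth_on_imp_DERIV:
  fixes f :: "real \<Rightarrow> real"
  assumes "smooth_on f S" "x \<in> S"
  shows "(f has_real_derivative deriv f x) (at x)"
  using smooth_on_imp_differentiable[OF assms] DERIV_deriv_iff_real_differentiable by blast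

lemma smooth_on_deriv:
  fixes f :: "real \<Rightarrow> real"
  assumes "open S" "smooth_on f S"
  shows "smooth_on (deriv f) S"
proof -
  have "frechet_derivative f (at x) 1 = deriv f x" if "x \<in> S" for x
    using smooth_on_imp_DERIV[OF assms(2) that]
    by (metis frechet_derivative_at has_field_derivative_def mult.right_neutral)
  then show ?thesis
    using smooth_on_frechet_derivative[OF assms(2), of 1] C_n_on_cong[OF assms(1)]
    unfolding smooth_on_def by metis
qed

text \<open>Smoothness of \<open>S\<close> is the case of the identity for \<open>\<phi>\<close>,
  but the induction on the order needs all smooth \<open>\<phi>\<close> at once: each
  differentiation replaces \<open>\<phi>\<close> by a multiple of
  \<open>deriv \<phi> * \<psi>\<close>.\<close>

lemma smooth_on_compose_integral_curve:
  fixes \<phi> \<psi> S :: "real \<Rightarrow> real"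
  assumes "open I" "open J" "S ` J \<subseteq> I" "smooth_on \<psi> I" "smooth_on \<phi> I"
    and S: "\<And>v. v \<in> J \<Longrightarrow> (S has_real_derivative \<psi> (S v)) (at v)"
  shows "smooth_on (\<lambda>v. \<phi> (S v)) J"
proof -
  have "C_n_on n (\<lambda>v. \<phi> (S v)) J" for n
    using assms(5)
  proof (induction n arbitrary: \<phi>)
    case 0
    have "continuous_on J S"
      using S by (meson DERIV_isCont continuous_at_imp_continuous_on)
    then show ?case
      using continuous_on_compose2[OF smooth_on_imp_continuous_on[OF 0] _ assms(3)] by simp
  next
    case (Suc n)
    show ?case
    proof (rule C_n_on_SucI[OF assms(2)])
      show "((\<lambda>v. \<phi> (S v)) has_derivative (\<lambda>h. deriv \<phi> (S v) * \<psi> (S v) * h)) (at v)"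
        if "v \<in> J" for v
        using DERIV_chain2[OF smooth_on_imp_DERIV[OF Suc.prems] S[OF that]] that assms(3)
        by (auto simp: has_field_derivative_def)
      have "smooth_on (\<lambda>t. deriv \<phi> t * \<psi> t * h) I" for h
        by (intro smooth_on_mult smooth_on_deriv smooth_on_const assms(1,4) Suc.prems)
      then show "C_n_on n (\<lambda>v. deriv \<phi> (S v) * \<psi> (S v) * h) J" for h
        using Suc.IH[of "\<lambda>t. deriv \<phi> t * \<psi> t * h" for h] by simp
    qed
  qed
  then show ?thesis by (simp add: smooth_on_def)
qed

section \<open>Partial derivatives of smooth functions of two variables\<close>

text \<open>The chain rule along the vertical line through \<open>(v, r)\<close> ties
  \<open>partial_r\<close>, a derivative of a slice, to the total derivative. Smoothness thereby
  passes to \<open>partial_r F\<close>.\<close>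

lemma smooth_on_imp_has_partial_r:
  assumes "smooth_on F U" "(v, r) \<in> U"
  shows "((\<lambda>r. F (v, r)) has_real_derivative frechet_derivative F (at (v, r)) (0, 1)) (at r)"
    and "partial_r F (v, r) = frechet_derivative F (at (v, r)) (0, 1)"
proof -
  let ?D = "frechet_derivative F (at (v, r))"
  have D: "(F has_derivative ?D) (at (v, r))"
    using smooth_on_imp_differentiable[OF assms] by (simp flip: frechet_derivative_works)
  have "((\<lambda>r. (v, r)) has_derivative (\<lambda>h. (0, h))) (at r)"
    by (intro has_derivative_Pair has_derivative_const has_derivative_ident)
  from has_derivative_compose[OF this D]
  have "((\<lambda>r. F (v, r)) has_derivative (\<lambda>h. ?D (0, h))) (at r)" .
  moreover have "(\<lambda>h. ?D (0, h)) = (*) (?D (0, 1))"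
  proof
    show "?D (0, h) = ?D (0, 1) * h" for h
      using linear_cmul[OF has_derivative_linear[OF D], of h "(0, 1)"]
      by (simp only: scaleR_Pair real_scaleR_def mult_zero_right mult_1_right mult.commute[of h])
  qed
  ultimately show "((\<lambda>r. F (v, r)) has_real_derivative ?D (0, 1)) (at r)"
    by (simp only: has_field_derivative_def)
  then show "partial_r F (v, r) = ?D (0, 1)"
    by (simp add: partial_r_def DERIV_imp_deriv)
qed

lemma smooth_on_partial_r:
  assumes "open U" "smooth_on F U"
  shows "smooth_on (partial_r F) U"
proof -
  have "frechet_derivative F (at p) (0, 1) = partial_r F p" if "p \<in> U" for p
    using smooth_on_imp_has_partial_r(2)[OF assms(2)] that by (cases p) simp
  then show ?thesis
    using smooth_on_frechet_derivative[OF assms(2), of "(0, 1)"] C_n_on_cong[OF assms(1)]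
    unfolding smooth_on_def by metis
qed

text \<open>Lets an identity valid on an open set of the plane be differentiated along either
  coordinate line.\<close>

lemma eventually_nhds_slices:
  fixes U :: "('a::topological_space \<times> 'b::topological_space) set"
  assumes "open U" "(v, r) \<in> U"
  shows "eventually (\<lambda>y. (v, y) \<in> U) (nhds r)" "eventually (\<lambda>x. (x, r) \<in> U) (nhds v)"
proof -
  obtain A B where "open A" "open B" "v \<in> A" "r \<in> B" "A \<times> B \<subseteq> U"
    using open_prod_elim[OF assms] by (metis mem_Sigma_iff)
  then show "eventually (\<lambda>y. (v, y) \<in> U) (nhds r)" "eventually (\<lambda>x. (x, r) \<in> U) (nhds v)"
    unfolding eventually_nhds by blast+
qed

text \<open>Since the decomposition of \<open>G\<close> is required only on \<open>U\<close>, the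
  rule can be iterated: the formula it yields for a first derivative is itself known only on an open
  set.\<close>

lemma partial_r_add:
  assumes "open U" "smooth_on F U" "(v, r) \<in> U"
    and "\<And>p. p \<in> U \<Longrightarrow> G p = F p + H p"
    and "((\<lambda>r. H (v, r)) has_real_derivative D) (at r)"
  shows "partial_r G (v, r) = partial_r F (v, r) + D"
proof -
  have "partial_r G (v, r) = deriv (\<lambda>r. F (v, r) + H (v, r)) r"
    unfolding partial_r_def fst_conv snd_conv
    by (rule deriv_cong_ev[OF eventually_mono[OF eventually_nhds_slices(1)[OF assms(1,3)]]])
      (simp_all add: assms(4))
  also have "\<dots> = partial_r F (v, r) + D"
    using DERIV_add[OF smooth_on_imp_has_partial_r(1)[OF assms(2,3)] assms(5)]
      smooth_on_imp_has_partial_r(2)[OF assms(2,3)] by (metis DERIV_imp_deriv)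
  finally show ?thesis .
qed

text \<open>
  No differentiability of \<open>f\<close> is needed: adding \<open>g\<close> does not change which numbers are
  derivatives of \<open>f\<close> at \<open>x\<close>, and \<open>deriv\<close> is a choice among these.
\<close>

lemma deriv_add_zero:
  fixes f g :: "real \<Rightarrow> real"
  assumes "(g has_real_derivative 0) (at x)"
  shows "deriv (\<lambda>x. f x + g x) x = deriv f x"
proof -
  have "((\<lambda>x. f x + g x) has_real_derivative D) (at x) \<longleftrightarrow> (f has_real_derivative D) (at x)" for D
    using DERIV_add[OF _ assms, of f D] DERIV_diff[OF _ assms, of "\<lambda>x. f x + g x" D] by auto
  then show ?thesis by (simp add: deriv_def)
qed

section \<open>Perturbing the mass function\<close>

text \<open>The corrections to \<open>M\<close>, \<open>partial_r M\<close> and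
  \<open>ricci_ext M\<close> carry the factors \<open>(r - g v) ^ 4\<close>,
  \<open>(r - g v) ^ 3\<close> and \<open>(r - g v) ^ 2\<close>. All vanish on \<Sigma>, which
  settles (M3)--(M5); the double zero of the last one settles (M6).\<close>

lemma matching_conditions_add_quartic:
  fixes g :: "real \<Rightarrow> real"
  assumes "open U" "open J" "smooth_on M U" "smooth_on g J"
    and \<Sigma>: "\<And>t. t \<in> I \<Longrightarrow> (T t, R t) \<in> U \<and> T t \<in> J \<and> g (T t) = R t \<and> R t > 0"
    and "matching_conditions r0 I a T R M"
  shows "matching_conditions r0 I a T R (\<lambda>p. M p + (snd p - g (fst p)) ^ 4)"
proof -
  define U' where "U' = U \<inter> J \<times> UNIV"
  define M' where "M' = (\<lambda>p. M p + (snd p - g (fst p)) ^ 4)"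
  have U': "open U'" using assms(1,2) by (simp add: U'_def open_Int open_Times)
  have M: "smooth_on M U'" using smooth_on_subset[OF assms(3)] by (simp add: U'_def)
  have r1: "partial_r M' p = partial_r M p + 4 * (snd p - g (fst p)) ^ 3" if "p \<in> U'" for p
  proof -
    have "((\<lambda>r. (snd (fst p, r) - g (fst (fst p, r))) ^ 4) has_real_derivative
        4 * (snd p - g (fst p)) ^ 3) (at (snd p))"
      by (auto intro!: derivative_eq_intros)
    from partial_r_add[OF U' M _ _ this, of M'] that show ?thesis by (simp add: M'_def)
  qed
  have r2: "partial_r (partial_r M') p = partial_r (partial_r M) p + 12 * (snd p - g (fst p)) ^ 2"
    if "p \<in> U'" for p
  proof -
    have "((\<lambda>r. 4 * (snd (fst p, r) - g (fst (fst p, r))) ^ 3) has_real_derivative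
        12 * (snd p - g (fst p)) ^ 2) (at (snd p))"
      by (auto intro!: derivative_eq_intros)
    from partial_r_add[OF U' smooth_on_partial_r[OF U' M] _ _ this, of "partial_r M'"] that
    show ?thesis by (simp add: r1)
  qed
  \<comment> \<open>\<open>K\<close> is the Ricci correction: \<open>12 * (r - g v) ^ 2\<close> and
    \<open>4 * (r - g v) ^ 3\<close>, the changes of the second and first
    \<open>r\<close>-derivatives, inserted into the linear expression
    \<open>ricci_ext\<close>.\<close>
  define K where "K = (\<lambda>p. 2 / (snd p)\<^sup>2 *
    (12 * snd p * (snd p - g (fst p)) ^ 2 + 8 * (snd p - g (fst p)) ^ 3))"
  have ric: "ricci_ext M' p = ricci_ext M p + K p" if "p \<in> U'" for p
    using r1[OF that] r2[OF that] by (simp add: ricci_ext_def K_def algebra_simps)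
  have "partial_v (ricci_ext M') (T t, R t) = partial_v (ricci_ext M) (T t, R t) \<and>
      partial_r (ricci_ext M') (T t, R t) = partial_r (ricci_ext M) (T t, R t)" if "t \<in> I" for t
  proof
    have mem: "(T t, R t) \<in> U'" and g: "g (T t) = R t" and pos: "R t > 0" and J: "T t \<in> J"
      using \<Sigma>[OF that] by (auto simp: U'_def)
    \<comment> \<open>Each term of this derivative keeps a factor \<open>R t - g (T t) = 0\<close>,
      whatever the slope of \<open>g\<close>.\<close>
    have "((\<lambda>v. K (v, R t)) has_real_derivative 0) (at (T t))"
      unfolding K_def using pos g
      by (auto intro!: derivative_eq_intros smooth_on_imp_DERIV[OF assms(4) J])
    moreover have "partial_v (ricci_ext M') (T t, R t)
        = deriv (\<lambda>v. ricci_ext M (v, R t) + K (v, R t)) (T t)"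
      unfolding partial_v_def fst_conv snd_conv
      by (rule deriv_cong_ev[OF eventually_mono[OF eventually_nhds_slices(2)[OF U' mem]]])
        (simp_all add: ric)
    ultimately show "partial_v (ricci_ext M') (T t, R t) = partial_v (ricci_ext M) (T t, R t)"
      by (simp add: deriv_add_zero partial_v_def)
    \<comment> \<open>Here the prefactor \<open>2 / r\<^sup>2\<close> is differentiated too;
      \<open>R t > 0\<close> keeps it regular.\<close>
    have "((\<lambda>r. K (T t, r)) has_real_derivative 0) (at (R t))"
      unfolding K_def using pos g by (auto intro!: derivative_eq_intros)
    moreover have "partial_r (ricci_ext M') (T t, R t)
        = deriv (\<lambda>r. ricci_ext M (T t, r) + K (T t, r)) (R t)"
      unfolding partial_r_def fst_conv snd_conv
      by (rule deriv_cong_ev[OF eventually_mono[OF eventually_nhds_slices(1)[OF U' mem]]])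
        (simp_all add: ric)
    ultimately show "partial_r (ricci_ext M') (T t, R t) = partial_r (ricci_ext M) (T t, R t)"
      by (simp add: deriv_add_zero partial_r_def)
  qed
  moreover have "M' (T t, R t) = M (T t, R t)
      \<and> partial_r M' (T t, R t) = partial_r M (T t, R t)
      \<and> ricci_ext M' (T t, R t) = ricci_ext M (T t, R t)" if "t \<in> I" for t
    using \<Sigma>[OF that] r1[of "(T t, R t)"] ric[of "(T t, R t)"] by (simp add: U'_def M'_def K_def)
  ultimately show ?thesis
    using assms(6) unfolding matching_conditions_def M'_def[symmetric] by metis
qed

section \<open>Inverting \<open>T\<close> and constructing the second exterior\<close>

text \<open>By the mean value theorem, equal values at two points would force a zero of
  \<open>f'\<close> between them, and an interval contains that zero.\<close>

lemma inj_on_if_deriv_nonzero: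
  fixes f :: "real \<Rightarrow> real"
  assumes "is_interval I"
    and "\<And>x. x \<in> I \<Longrightarrow> (f has_real_derivative f' x) (at x)" "\<And>x. x \<in> I \<Longrightarrow> f' x \<noteq> 0"
  shows "inj_on f I"
proof (rule linorder_inj_onI')
  fix x y assume xy: "x \<in> I" "y \<in> I" "x < y"
  have sub: "z \<in> I" if "x \<le> z" "z \<le> y" for z
    using assms(1) xy that by (meson is_interval_1)
  obtain z where "x < z" "z < y" "f y - f x = (y - x) * f' z"
    using MVT2[OF xy(3), of f f'] assms(2) sub by blast
  then show "f x \<noteq> f y" using assms(3)[OF sub, of z] xy by auto
qed

theorem proposition3:
  fixes r0 :: real and I :: "real set" and a T R :: "real \<Rightarrow> real"
    and M :: "real \<times> real \<Rightarrow> real" and U :: "(real \<times> real) set"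
  assumes "r0 > 0"
    and "open I" and "is_interval I" and "I \<noteq> {}"
    and "smooth_on a I" and "\<And>t. t \<in> I \<Longrightarrow> a t > 0"
    and "\<And>t. t \<in> I \<Longrightarrow> 1 - r0 * deriv a t \<noteq> 0"
    and "open U" and "hypersurface I T R \<subseteq> U" and "smooth_on M U"
    and "matching_conditions r0 I a T R M"
  shows "\<exists>M' U'. open U' \<and> hypersurface I T R \<subseteq> U' \<and> smooth_on M' U' \<and>
           matching_conditions r0 I a T R M' \<and>
           (\<forall>W. hypersurface I T R \<subseteq> interior W \<longrightarrow>
              (\<exists>p \<in> W \<inter> U \<inter> U' \<inter> exterior_side I T R. M' p \<noteq> M p))"
proof -
  \<comment> \<open>By (M2) \<open>\<psi>\<close> is the reciprocal of the derivative of
    \<open>T\<close>, hence the velocity of the inverse \<open>S\<close>.\<close>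
  define \<psi> where "\<psi> t = 1 - r0 * deriv a t" for t
  define S where "S = inv_into I T"
  define J where "J = T ` I"
  have R: "R t = r0 * a t" and T': "(T has_real_derivative 1 / \<psi> t) (at t)" if "t \<in> I" for t
    using assms(11) that by (auto simp: matching_conditions_def \<psi>_def)
  have \<psi>0: "\<psi> t \<noteq> 0" if "t \<in> I" for t using assms(7)[OF that] by (simp add: \<psi>_def)
  have \<psi>: "smooth_on \<psi> I"
    unfolding \<psi>_def by (intro smooth_on_diff smooth_on_mult smooth_on_const smooth_on_deriv assms(2,5))
  have inj: "inj_on T I"
    using inj_on_if_deriv_nonzero[OF assms(3) T'] \<psi>0 by simp
  have cont: "continuous_on I T"
    using T' by (meson DERIV_isCont continuous_at_imp_continuous_on)
  have J: "open J"
    unfolding J_def using invariance_of_domain[OF cont assms(2) inj] .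
  have ST: "S (T t) = t" if "t \<in> I" for t using inj that by (simp add: S_def)
  \<comment> \<open>The inverse function theorem gives the slope \<open>\<psi> t\<close> at
    \<open>T t\<close>; writing \<open>t = S v\<close> turns this into the autonomous equation
    \<open>S' = \<psi> \<circ> S\<close>.\<close>
  have S': "(S has_real_derivative \<psi> (S v)) (at v)" if v: "v \<in> J" for v
  proof -
    obtain t where t: "t \<in> I" "v = T t" using v by (auto simp: J_def)
    have "(S has_derivative (*) (\<psi> t)) (at (T t))"
    proof (rule has_derivative_inverse_strong[OF assms(2) t(1) cont ST])
      show "(T has_derivative (*) (1 / \<psi> t)) (at t)"
        using T'[OF t(1)] by (simp only: has_field_derivative_def)
    qed (use \<psi>0[OF t(1)] in \<open>simp_all add: fun_eq_iff\<close>)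
    then show ?thesis using ST t by (simp add: has_field_derivative_def)
  qed
  \<comment> \<open>This is \<open>R \<circ> S\<close> on \<open>J\<close>, written by (M1) through
    \<open>a\<close>, for which smoothness is a hypothesis.\<close>
  define g where "g v = r0 * a (S v)" for v
  have SJ: "S ` J \<subseteq> I" using ST by (auto simp: J_def)
  have g: "smooth_on g J"
    unfolding g_def
    by (intro smooth_on_mult smooth_on_const J
        smooth_on_compose_integral_curve[OF assms(2) J SJ \<psi> assms(5) S'])
  have \<Sigma>: "(T t, R t) \<in> U \<and> T t \<in> J \<and> g (T t) = R t \<and> R t > 0" if "t \<in> I" for t
    using that assms(1,6,9) R ST by (auto simp: hypersurface_def J_def g_def)
  define M' where "M' = (\<lambda>p. M p + (snd p - g (fst p)) ^ 4)"
  \<comment> \<open>The strip over \<open>J\<close> is where \<open>g\<close>, and with it the added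
    quartic, is known to be smooth.\<close>
  define U' where "U' = U \<inter> J \<times> UNIV"
  have U': "open U'" using assms(8) J by (simp add: U'_def open_Int open_Times)
  have \<Sigma>U': "hypersurface I T R \<subseteq> U'" using \<Sigma> by (auto simp: hypersurface_def U'_def)
  have "smooth_on M' U'"
    unfolding M'_def
  proof (intro smooth_on_add smooth_on_power smooth_on_diff U')
    show "smooth_on M U'" using smooth_on_subset[OF assms(10)] by (simp add: U'_def)
    show "smooth_on snd U'" by (rule smooth_on_bounded_linear[OF U' bounded_linear_snd])
    show "smooth_on (\<lambda>p. g (fst p)) U'"
      by (rule smooth_on_compose_linear[OF U' bounded_linear_fst _ g]) (auto simp: U'_def)
  qed
  moreover have "matching_conditions r0 I a T R M'"
    unfolding M'_def using matching_conditions_add_quartic[OF assms(8) J assms(10) g \<Sigma> assms(11)] .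
  moreover have "\<exists>p \<in> W \<inter> U \<inter> U' \<inter> exterior_side I T R. M' p \<noteq> M p"
    if W: "hypersurface I T R \<subseteq> interior W" for W
  proof -
    \<comment> \<open>Any single point of \<Sigma> suffices: moving slightly upwards in
      \<open>r\<close> from it stays in the open set \<open>interior W \<inter> U'\<close>, enters
      the exterior side, and makes the quartic positive.\<close>
    obtain t where t: "t \<in> I" using assms(4) by blast
    have "(T t, R t) \<in> interior W \<inter> U'"
      using W \<Sigma>U' t by (auto simp: hypersurface_def)
    then have "eventually (\<lambda>y. (T t, y) \<in> interior W \<inter> U') (nhds (R t))"
      by (intro eventually_nhds_slices(1) open_Int open_interior U')
    \<comment> \<open>The right-sided filter adds \<open>R t < y\<close> and is nontrivial on the
      reals, so a suitable \<open>y\<close> exists.\<close>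
    then have "eventually (\<lambda>y. (T t, y) \<in> interior W \<inter> U') (at_right (R t))"
      using eventually_nhds_conv_at filter_leD[OF at_le[of "{R t<..}" UNIV "R t"]] by blast
    then have "eventually (\<lambda>y. (T t, y) \<in> interior W \<inter> U' \<and> R t < y) (at_right (R t))"
      using eventually_at_right_less by (rule eventually_conj)
    then obtain y where y: "(T t, y) \<in> interior W \<inter> U'" "R t < y"
      using eventually_happens' trivial_limit_at_right_real by blast
    moreover have "M' (T t, y) \<noteq> M (T t, y)"
      using y \<Sigma>[OF t] by (simp add: M'_def)
    ultimately show ?thesis
      using t interior_subset by (intro bexI[of _ "(T t, y)"]) (auto simp: exterior_side_def U'_def)
  qed
  ultimately show ?thesis using U' \<Sigma>U' by blast
qed

end
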